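(* Let $\beta_0 := \log_2(3/2)$. For every integer $n \ge 1$ and every $A \subset \{0,1\}^n$, $$\mathbb{E}\, h_A^{\beta_0} \;\ge\; \mu(A)^{*}\,\bigl(\log_2(1/\mu(A)^{*})\bigr)^{\beta_0}.$$ In particular, if $\mu(A) \le 1/2$, then $$\mathbb{E}\, h_A^{\beta} \;\ge\; \mu(A)\,\bigl(\log_2(1/\mu(A))\bigr)^{\beta} \qquad \text{for all } \beta \ge \log_2(3/2).$$ Equality holds in both inequalities whenever $A \subset \{0,1\}^n$ is a subcube.
   Context: The hypercube $\{0,1\}^n$ is regarded as a graph in which two vertices are adjacent iff they differ in exactly one coordinate. $\mu$ is the uniform probability measure on $\{0,1\}^n$ and $\mathbb{E}$ is expectation with respect to $\mu$. For $A \subset \{0,1\}^n$, the function $h_A:\{0,1\}^n \to \mathbb{R}$ is defined by $h_A(x)=0$ if $x \notin A$, and, if $x \in A$, $h_A(x)$ is the number of neighbours of $x$ lying in $A^c = \{0,1\}^n\setminus A$. For $t \in [0,1]$, $t^{*} = \min\{t,1-t\}$. The expression $t(\log_2(1/t))^{\beta}$ is understood as $0$ at $t=0$. A subcube is a set obtained by fixing the values of some of the coordinates. *)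

theory Defs
  imports "HOL-Probability.Probability"
begin

definition hypercube :: "nat \<Rightarrow> (nat \<Rightarrow> nat) set" where
  "hypercube n = {..<n} \<rightarrow>\<^sub>E {0, 1}"

definition adjacent :: "nat \<Rightarrow> (nat \<Rightarrow> nat) \<Rightarrow> (nat \<Rightarrow> nat) \<Rightarrow> bool" where
  "adjacent n x y \<longleftrightarrow>
     x \<in> hypercube n \<and> y \<in> hypercube n \<and> (\<exists>!i. i < n \<and> x i \<noteq> y i)"

definition cube_measure :: "nat \<Rightarrow> (nat \<Rightarrow> nat) measure" where
  "cube_measure n = uniform_count_measure (hypercube n)"

definition h :: "nat \<Rightarrow> (nat \<Rightarrow> nat) set \<Rightarrow> (nat \<Rightarrow> nat) \<Rightarrow> real" where
  "h n A x = (if x \<in> A then real (card {y \<in> hypercube n - A. adjacent n x y}) else 0)"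

definition star :: "real \<Rightarrow> real" where
  "star t = min t (1 - t)"

text \<open>
  The value at \<open>t = 0\<close> is \<open>0\<close> thanks to the leading factor; for \<open>t = 1\<close> the
  library convention \<open>0 powr \<beta> = 0\<close> gives the usual value for \<open>\<beta> > 0\<close>.
\<close>
definition t_log_pow :: "real \<Rightarrow> real \<Rightarrow> real" where
  "t_log_pow \<beta> t = t * (log 2 (1 / t)) powr \<beta>"

definition beta0 :: real where
  "beta0 = log 2 (3 / 2)"

text \<open>The set \<open>I\<close> of fixed coordinates may be empty, so the whole hypercube is a subcube.\<close>
definition subcube :: "nat \<Rightarrow> (nat \<Rightarrow> nat) set \<Rightarrow> bool" where
  "subcube n A \<longleftrightarrow>
     (\<exists>I \<subseteq> {..<n}. \<exists>a \<in> I \<rightarrow>\<^sub>E {0, 1}. A = {x \<in> hypercube n. \<forall>i \<in> I. x i = a i})"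

end

theory Submission
  imports Defs
begin

text \<open>
  The bound is proved by induction on the dimension for a stronger profile \<open>b = isop\<close>, symmetric
  about \<open>1/2\<close>: it is the maximum of \<open>2x(1 - x)\<close> and \<open>L(x) = x (log 2 (1/x)) powr beta0\<close> on \<open>[0, 1/4]\<close>,
  and \<open>2x(1 - x)\<close> on \<open>[1/4, 1/2]\<close>. Let \<open>A\<close> have slices of measures \<open>x \<ge> y\<close> in the last coordinate.
  The function \<open>h\<close> of \<open>A\<close> on the larger slice exceeds that of the slice by 1 on a set of measure at least
  \<open>x - y\<close>. Reverse Minkowski, respectively \<open>(k + 1) powr beta0 \<ge> 1 + k powr beta0 / 2\<close> for
  natural \<open>k\<close>, bounds its contribution below by \<open>(b(x)\<^sup>p + (x - y)\<^sup>p)\<^sup>1\<^sup>/\<^sup>p\<close> with \<open>p = 1 / beta0\<close>,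
  respectively by \<open>x - y + b(x) / 2\<close>. It remains to show that the larger of these plus \<open>b(y)\<close> is
  at least \<open>2 b((x + y) / 2)\<close>. For \<open>2x(1 - x)\<close> this reduces to \<open>1 + z / 2 \<le> (1 + z) powr beta0\<close> on
  \<open>[0, 1]\<close>; for \<open>L\<close> it reduces by concavity to the case of midpoint \<open>1/4\<close>.
  Exponents above \<open>beta0\<close> follow from Jensen's inequality.
\<close>

subsection \<open>Elementary inequalities\<close>

text \<open>Logarithms of the comparisons \<open>2 ^ 4 <= (3/2) ^ 7\<close> and
  \<open>(3/2) ^ 5 <= 2 ^ 3\<close>.\<close>

lemma beta0_bounds: "4/7 \<le> beta0" "beta0 \<le> 3/5"
proof -
  have "4 = log 2 ((2::real) ^ 4)"
    by (subst log_nat_power) auto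
  also have "\<dots> \<le> log 2 ((3/2::real) ^ 7)"
    by (subst log_le_cancel_iff) (auto simp: power_divide)
  also have "\<dots> = 7 * beta0"
    by (simp add: log_nat_power beta0_def)
  finally show "4/7 \<le> beta0" by simp
  have "5 * beta0 = log 2 ((3/2::real) ^ 5)"
    by (simp add: log_nat_power beta0_def)
  also have "\<dots> \<le> log 2 (2 ^ 3)"
    by (subst log_le_cancel_iff) (auto simp: power_divide)
  also have "\<dots> = 3"
    by (subst log_nat_power) auto
  finally show "beta0 \<le> 3/5" by simp
qed

lemma beta0_pos [simp]: "0 < beta0" and beta0_less_1 [simp]: "beta0 < 1"
  and beta0_nonneg [simp]: "0 \<le> beta0" and beta0_le_1 [simp]: "beta0 \<le> 1"
  and beta0_nz [simp]: "beta0 \<noteq> 0"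
  using beta0_bounds by auto

lemma two_powr_beta0: "2 powr beta0 = 3/2"
  by (simp add: beta0_def)

text \<open>Weighted AM-GM, zero entries included. With \<open>a = 1\<close> it is the tangent of a
  power at 1, the source of most concavity and convexity bounds below.\<close>

lemma powr_one_sub_mult_le:
  fixes a b \<beta> :: real
  assumes "a \<ge> 0" "b \<ge> 0" "0 < \<beta>" "\<beta> < 1"
  shows "a powr (1 - \<beta>) * b powr \<beta> \<le> (1 - \<beta>) * a + \<beta> * b"
proof (cases "a = 0 \<or> b = 0")
  case False
  then show ?thesis
    using assms Youngs_inequality_0[of "1 - \<beta>" \<beta> a b] by auto
qed (use assms in auto)

text \<open>Both powers lie below the tangent at the mean \<open>M\<close>, and the tangent values
  average to \<open>M powr \<beta>\<close>.\<close>

lemma powr_concave_combination: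
  fixes a b u v \<beta> :: real
  assumes "a \<ge> 0" "b \<ge> 0" "u \<ge> 0" "v \<ge> 0" "u + v = 1" "0 < \<beta>" "\<beta> < 1"
  shows "u * a powr \<beta> + v * b powr \<beta> \<le> (u * a + v * b) powr \<beta>"
proof (cases "u * a + v * b = 0")
  case True
  then have "u * a = 0" "v * b = 0"
    using assms by (smt (verit) mult_nonneg_nonneg)+
  then show ?thesis by auto
next
  case False
  define M where "M = u * a + v * b"
  have M: "M > 0"
    using False assms unfolding M_def by (smt (verit) mult_nonneg_nonneg)
  have *: "c powr \<beta> \<le> M powr \<beta> * ((1 - \<beta>) + \<beta> * (c / M))" if "c \<ge> 0" for c
  proof -
    have "(c / M) powr \<beta> \<le> (1 - \<beta>) + \<beta> * (c / M)"
      using powr_one_sub_mult_le[of 1 "c / M" \<beta>] assms that M by auto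
    then show ?thesis
      using M by (simp add: powr_divide divide_le_eq mult.commute)
  qed
  have "u * a powr \<beta> + v * b powr \<beta>
      \<le> u * (M powr \<beta> * ((1 - \<beta>) + \<beta> * (a / M))) + v * (M powr \<beta> * ((1 - \<beta>) + \<beta> * (b / M)))"
    by (intro add_mono mult_left_mono * assms)
  also have "\<dots> = M powr \<beta> * ((1 - \<beta>) * (u + v) + \<beta> * ((u * a + v * b) / M))"
    by (simp add: algebra_simps add_divide_distrib)
  also have "\<dots> = M powr \<beta>"
    using M assms by (simp flip: M_def)
  finally show ?thesis by (simp add: M_def)
qed

text \<open>
  Two-term Hoelder inequality for the exponents \<open>1 / (1 - \<beta>)\<close> and \<open>1 / \<beta>\<close>. It bounds the
  convex function \<open>(f + g) powr \<beta>\<close> of \<open>f powr \<beta>\<close>, \<open>g powr \<beta>\<close> from below by a linear one, so that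
  it can be summed pointwise.
\<close>

lemma powr_dual_le:
  fixes X Y f g \<beta> :: real
  assumes "X \<ge> 0" "Y \<ge> 0" "X + Y > 0" "f \<ge> 0" "g \<ge> 0" "0 < \<beta>" "\<beta> < 1"
  shows "(X / (X + Y)) powr (1 - \<beta>) * f powr \<beta> + (Y / (X + Y)) powr (1 - \<beta>) * g powr \<beta>
    \<le> (f + g) powr \<beta>"
proof (cases "f + g = 0")
  case True
  then have "f = 0" "g = 0" using assms by auto
  then show ?thesis by simp
next
  case False
  define S where "S = f + g"
  have S: "S > 0" using False assms by (auto simp: S_def)
  have "(X / (X + Y)) powr (1 - \<beta>) * (f / S) powr \<beta> + (Y / (X + Y)) powr (1 - \<beta>) * (g / S) powr \<beta>
     \<le> ((1 - \<beta>) * (X / (X + Y)) + \<beta> * (f / S)) + ((1 - \<beta>) * (Y / (X + Y)) + \<beta> * (g / S))"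
    using assms S by (intro add_mono powr_one_sub_mult_le) auto
  also have "\<dots> = (1 - \<beta>) * ((X + Y) / (X + Y)) + \<beta> * ((f + g) / S)"
    unfolding add_divide_distrib distrib_left by simp
  also have "\<dots> = (1 - \<beta>) * 1 + \<beta> * 1"
    using assms S unfolding S_def by (metis divide_self_if less_numeral_extra(3))
  also have "\<dots> = 1" by simp
  finally show ?thesis
    using S by (simp add: powr_divide[of _ S] flip: S_def)
       (simp add: divide_simps)
qed

text \<open>The chord of the concave power over \<open>[1, 2]\<close>; its slope is 1/2 because
  \<open>2 powr beta0 = 3/2\<close>.\<close>

lemma one_plus_powr_ge:
  fixes z :: real
  assumes "0 \<le> z" "z \<le> 1"
  shows "1 + z / 2 \<le> (1 + z) powr beta0"
  using powr_concave_combination[of 1 2 "1 - z" z beta0] assms two_powr_beta0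
  by (simp add: algebra_simps)

lemma one_minus_powr_ge:
  fixes z :: real
  assumes "-1/2 \<le> z" "z \<le> 0"
  shows "1 + 2 / 3 * z \<le> (1 + z) powr beta0"
proof -
  have half: "(1/2) powr beta0 = 2/3"
    by (simp add: powr_divide two_powr_beta0)
  show ?thesis
    using powr_concave_combination[of 1 "1/2" "1 + 2 * z" "- 2 * z" beta0] assms
    by (simp add: half add.commute)
qed

text \<open>AM-GM bounds the reciprocal of the power by \<open>1 - u\<close> with
  \<open>u = beta0 * w\<close>; then \<open>1 / (1 - u) >= 1 + u\<close> for
  \<open>u < 1\<close>.\<close>

lemma one_plus_powr_ge_tangent:
  fixes z :: real
  assumes "-1 < z"
  shows "1 + beta0 * (z / (1 + z)) \<le> (1 + z) powr beta0"
proof -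
  define w where "w = z / (1 + z)"
  have w: "1 / (1 + z) = 1 - w" "w < 1"
    using assms by (auto simp: w_def field_simps)
  have "(1 / (1 + z)) powr beta0 \<le> 1 - beta0 * w"
    using powr_one_sub_mult_le[of 1 "1 / (1 + z)" beta0] assms w(2) unfolding w(1)
    by (simp add: algebra_simps)
  then have le: "1 \<le> (1 - beta0 * w) * (1 + z) powr beta0"
    using assms by (simp add: powr_divide divide_le_eq)
  then have pos: "0 < 1 - beta0 * w"
    by (smt (verit) mult_nonpos_nonneg powr_ge_zero)
  have "(1 - beta0 * w) * (1 + beta0 * w) \<le> 1"
    using zero_le_power2[of "beta0 * w"] by (simp add: algebra_simps power2_eq_square)
  also note le
  finally have "1 + beta0 * w \<le> (1 + z) powr beta0"
    using pos by simp
  then show ?thesis by (simp add: w_def)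
qed

text \<open>Equivalently, the convex function \<open>2 powr t\<close> lies below its chord on
  \<open>[0, 1]\<close>.\<close>

lemma log2_one_plus_ge:
  fixes t :: real
  assumes "0 \<le> t" "t \<le> 1"
  shows "t \<le> log 2 (1 + t)"
proof -
  have "(2::real) powr t \<le> 1 + t"
  proof (cases "t = 0 \<or> t = 1")
    case False
    then show ?thesis
      using powr_one_sub_mult_le[of 1 2 t] assms by auto
  qed auto
  then show ?thesis
    using assms by (simp add: le_log_iff)
qed

lemma log2_le:
  fixes c :: real
  assumes "c \<ge> 1"
  shows "log 2 c \<le> 2 * (c - 1)"
proof -
  have "ln c \<le> c - 1"
    using assms by (intro ln_le_minus_one) auto
  also have "\<dots> \<le> (c - 1) * (2 * ln 2)"
    using assms ln2_ge_two_thirds by (intro mult_left_mono[of 1 "2 * ln 2", simplified]) auto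
  finally show ?thesis
    by (simp add: log_def field_simps)
qed

lemma log2_complement_ge:
  fixes r :: real
  assumes "0 \<le> r" "r \<le> 1/2"
  shows "- (2 * r) \<le> log 2 (1 - r)"
proof -
  have "1 - 2 * r \<le> log 2 (2 * (1 - r))"
    using log2_one_plus_ge[of "1 - 2 * r"] assms by (simp add: algebra_simps)
  also have "log 2 (2 * (1 - r)) = 1 + log 2 (1 - r)"
    using assms by (subst log_mult) auto
  finally show ?thesis by simp
qed

text \<open>The left-hand side is \<open>2 * (1 - H)\<close> with \<open>H\<close> the binary
  entropy of \<open>(1 + r) / 2\<close>. The gap, scaled by \<open>ln 2\<close>, vanishes at 0 and
  has derivative at least \<open>(2 * ln 2 - 1) * x\<close>.\<close>

lemma entropy_deficit_le:
  fixes r :: real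
  assumes "0 \<le> r" "r \<le> 1/2"
  shows "(1 + r) * log 2 (1 + r) + (1 - r) * log 2 (1 - r) \<le> 2 * r\<^sup>2"
proof -
  define f where "f = (\<lambda>x::real. 2 * ln 2 * x\<^sup>2 - ((1 + x) * ln (1 + x) + (1 - x) * ln (1 - x)))"
  have "f 0 \<le> f r"
  proof (rule DERIV_nonneg_imp_nondecreasing[OF assms(1)])
    fix x :: real assume x: "0 \<le> x" "x \<le> r"
    then have x': "x \<le> 1/2" using assms by simp
    have "(f has_real_derivative (4 * ln 2 * x - (ln (1 + x) - ln (1 - x)))) (at x)"
      unfolding f_def using x x' by (auto intro!: derivative_eq_intros)
    moreover have "ln (1 + x) \<le> x"
      using x by (intro ln_add_one_self_le_self) auto
    moreover have "- (2 * x) * ln 2 \<le> ln (1 - x)"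
      using log2_complement_ge[of x] x x' by (simp add: log_def field_simps)
    moreover have "x \<le> 2 * ln 2 * x"
      using ln2_ge_two_thirds x mult_right_mono[of 1 "2 * ln 2" x] by simp
    ultimately show "\<exists>y. (f has_real_derivative y) (at x) \<and> 0 \<le> y"
      by (intro exI[of _ "4 * ln 2 * x - (ln (1 + x) - ln (1 - x))"]) (auto simp: algebra_simps)
  qed
  then have "(1 + r) * ln (1 + r) + (1 - r) * ln (1 - r) \<le> 2 * r\<^sup>2 * ln 2"
    by (simp add: f_def algebra_simps)
  then show ?thesis
    by (simp add: log_def divide_simps)
qed

subsection \<open>The two-point inequality for the logarithmic profile\<close>

lemma inverse_beta0_bounds: "5/3 \<le> 1 / beta0" "1 / beta0 \<le> 7/4"
  using beta0_bounds by (simp_all add: field_simps)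

text \<open>The fraction is largest at \<open>A = s\<^sup>2 - s\<close>. Substituting
  \<open>s = w ^ 4\<close> factors out \<open>w ^ 7 * (1 - w)\<close> and leaves the inequality
  \<open>poly\<close>, whose sides are separated by 7/4.\<close>

lemma powr_seven_quarters_ge:
  fixes s A :: real
  assumes "0 \<le> s" "s \<le> 1" and A: "s\<^sup>2 - s \<le> A" "A \<le> 0"
  shows "s\<^sup>2 + A\<^sup>2 / (2 + A) \<le> s powr (7/4)"
proof (cases "s = 0")
  case False
  define w where "w = s powr (1/4)"
  have w: "0 < w" "w \<le> 1"
    using assms False by (auto simp: w_def powr_le1)
  have s: "s = w ^ 4"
    using assms False by (simp add: w_def powr_power)
  have s7: "s powr (7/4) = w ^ 7"
    using assms False by (simp add: w_def powr_power)
  define v where "v = w ^ 2"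
  have v: "0 \<le> v" "v \<le> 1" using w by (auto simp: v_def power_le_one)
  \<comment> \<open>This tangent bound eliminates the odd powers of \<open>w\<close>, leaving a
    quartic in \<open>v\<close>.\<close>
  have "0 \<le> (w - 3/4)\<^sup>2" by simp
  then have wv: "w \<le> 2/3 * v + 3/8"
    by (simp add: v_def power2_eq_square algebra_simps)
  have "w * (1 + w + w^2 + w^3) = w * (1 + v) + v + v^2"
    by (simp add: v_def power_numeral_reduce algebra_simps)
  also have "\<dots> \<le> (2/3 * v + 3/8) * (1 + v) + v + v^2"
    using wv v by (intro add_mono mult_right_mono) auto
  finally have "(1 - s) * (w * (1 + w + w^2 + w^3)) \<le> (1 - v^2) * ((2/3 * v + 3/8) * (1 + v) + v + v^2)"
    using w v by (simp add: s v_def flip: power_mult) (intro mult_left_mono; simp add: power_le_one)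
  also have "\<dots> \<le> 7/4"
  proof -
    \<comment> \<open>Tangent bounds for \<open>v ^ 3\<close> at \<open>v = 3/5\<close> and for
      \<open>v ^ 4\<close> at \<open>v\<^sup>2 = 2/5\<close>, both near the maximiser of the
      quartic.\<close>
    have "0 \<le> (v - 3/5)\<^sup>2 * (v + 6/5)" using v by simp
    also have "\<dots> = v ^ 3 - 27/25 * v + 54/125"
      by (simp add: power2_eq_square power3_eq_cube field_simps)
    finally have "27/25 * v \<le> v ^ 3 + 54/125" by simp
    moreover have "0 \<le> (v\<^sup>2 - 2/5)\<^sup>2" by simp
    then have "4/5 * v ^ 2 \<le> v ^ 4 + 4/25"
      by (simp add: power2_eq_square power4_eq_xxxx field_simps)
    moreover have "(1 - v^2) * ((2/3 * v + 3/8) * (1 + v) + v + v^2)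
        = 3/8 + 49/24 * v + 31/24 * v^2 - 49/24 * v ^ 3 - 5/3 * v ^ 4"
      by (simp add: power2_eq_square power3_eq_cube power4_eq_xxxx field_simps)
    moreover have "0 \<le> v ^ 3" "0 \<le> v ^ 2"
      using v by auto
    ultimately show ?thesis using v by linarith
  qed
  also have "\<dots> \<le> 2 - s + s\<^sup>2"
    using zero_le_power2[of "s - 1/2"] by (simp add: power2_eq_square algebra_simps)
  finally have poly: "(1 - s) * (w * (1 + w + w^2 + w^3)) \<le> 2 - s + s\<^sup>2" .
  have ss: "s\<^sup>2 \<le> s" using assms by (simp add: power2_eq_square mult_left_le)
  have pos: "0 < 2 - s + s\<^sup>2"
    using assms by (smt (verit) zero_le_power2)
  have "A\<^sup>2 / (2 + A) \<le> (s - s\<^sup>2)\<^sup>2 / (2 - s + s\<^sup>2)"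
    using A ss assms pos by (intro frac_le power2_le_iff_abs_le[THEN iffD2]) auto
  also have "\<dots> \<le> w ^ 7 * (1 - w)"
  proof -
    have "(s - s\<^sup>2)\<^sup>2 = w^7 * (1 - w) * ((1 - s) * (w * (1 + w + w^2 + w^3)))"
      by (simp add: s power_numeral_reduce algebra_simps)
    also have "\<dots> \<le> w^7 * (1 - w) * (2 - s + s\<^sup>2)"
      using w by (intro mult_left_mono poly) auto
    finally show ?thesis
      using pos by (simp add: divide_le_eq)
  qed
  also have "\<dots> = s powr (7/4) - s\<^sup>2"
    by (simp add: s7) (simp add: s algebra_simps power_numeral_reduce)
  finally show ?thesis by simp
qed (use A in auto)

text \<open>
  The two-point inequality for \<open>t_log_pow beta0\<close> at the points \<open>(1 + r) / 4\<close>, \<open>(1 - r) / 4\<close>, divided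
  by \<open>3 / 8\<close>. For \<open>r \<ge> 1/2\<close> chords of the power function suffice. For \<open>r \<le> 1/2\<close> the first-order terms
  cancel up to an entropy deficit, and \<open>s powr (7/4)\<close> with \<open>s = 2 * r / (1 + r)\<close> dominates
  the quadratic remainder.
\<close>

lemma two_point_at_quarter:
  fixes r :: real
  assumes r: "0 \<le> r" "r < 1"
  defines "A \<equiv> (2 * r / (1 + r)) powr (1 / beta0) - log 2 (1 + r)"
  defines "B \<equiv> - log 2 (1 - r)"
  shows "- 1 \<le> A" "0 \<le> B"
    "2 \<le> (1 + r) * (1 + A / 2) powr beta0 + (1 - r) * (1 + B / 2) powr beta0"
proof -
  define s where "s = 2 * r / (1 + r)"
  have s: "0 \<le> s" "s \<le> 1" using r by (auto simp: s_def field_simps)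
  have rs: "(1 + r) * (1 - s) = 1 - r" "2 - s = 2 / (1 + r)"
    using r by (simp_all add: s_def field_simps)
  have rs3: "(1 + r) * s\<^sup>2 = 4 * r\<^sup>2 / (1 + r)"
    using r by (simp add: s_def power2_eq_square)
  have "1 - s \<le> log 2 (2 / (1 + r))"
    using log2_one_plus_ge[of "1 - s"] s rs(2) by simp
  also have "\<dots> = 1 - log 2 (1 + r)"
    using r by (subst log_divide) auto
  finally have log_le: "log 2 (1 + r) \<le> s" by simp
  have A_def': "A = s powr (1 / beta0) - log 2 (1 + r)"
    by (simp add: A_def s_def)
  have s74: "s powr (7/4) \<le> s powr (1 / beta0)"
    using s inverse_beta0_bounds by (intro powr_mono') auto
  have s2: "s\<^sup>2 \<le> s powr (7/4)"
    using powr_mono'[of "7/4" 2 s] s by simp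
  have A1: "s\<^sup>2 - s \<le> A" using s74 s2 log_le by (simp add: A_def')
  \<comment> \<open>The tangent of \<open>s powr (7/4)\<close> at \<open>s = 1\<close>, solved for
    \<open>s\<close>.\<close>
  have "s \<le> 3/7 + 4/7 * s powr (7/4)"
    using powr_one_sub_mult_le[of 1 "s powr (7/4)" "4/7"] s by (simp add: powr_powr)
  then have A2: "3/4 * s - 3/4 \<le> A"
    using s74 log_le unfolding A_def' by (simp add: field_simps)
  show Am1: "- 1 \<le> A" using A2 s by linarith
  show B: "0 \<le> B" using r by (simp add: B_def)
  have B1: "1 \<le> (1 + B / 2) powr beta0"
    using B by (intro ge_one_powr_ge_zero) auto
  show "2 \<le> (1 + r) * (1 + A / 2) powr beta0 + (1 - r) * (1 + B / 2) powr beta0"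
  proof (cases "A \<ge> 0")
    case True
    then have "1 \<le> (1 + A / 2) powr beta0"
      by (intro ge_one_powr_ge_zero) auto
    then have "(1 + r) * 1 + (1 - r) * 1 \<le> (1 + r) * (1 + A / 2) powr beta0 + (1 - r) * (1 + B / 2) powr beta0"
      using B1 r by (intro add_mono mult_left_mono) auto
    then show ?thesis by simp
  next
    case A: False
    show ?thesis
    proof (cases "r \<ge> 1/2")
      case True
      have "log 2 (1 - r) \<le> log 2 (1/2)"
        using r True by (subst log_le_cancel_iff) auto
      then have "1 \<le> B" by (simp add: B_def log_divide)
      have "5/4 \<le> (1 + 1/2) powr beta0"
        using one_plus_powr_ge[of "1/2"] by simp
      also have "\<dots> \<le> (1 + B / 2) powr beta0"
        using \<open>1 \<le> B\<close> by (intro powr_mono2) auto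
      finally have B2: "5/4 \<le> (1 + B / 2) powr beta0" .
      \<comment> \<open>The loss \<open>(1 + r) * (1 - s) / 4 = (1 - r) / 4\<close> from this term
        equals the gain from \<open>B2\<close>.\<close>
      have "1 - (1 - s) / 4 = 1 + 2/3 * ((3/4 * s - 3/4) / 2)"
        by (simp add: field_simps)
      also have "\<dots> \<le> 1 + 2/3 * (A / 2)"
        using A2 by (intro add_left_mono mult_left_mono divide_right_mono) auto
      also have "\<dots> \<le> (1 + A / 2) powr beta0"
        using A Am1 by (intro one_minus_powr_ge) auto
      finally have "(1 + r) * (1 - (1 - s) / 4) + (1 - r) * (5/4)
          \<le> (1 + r) * (1 + A / 2) powr beta0 + (1 - r) * (1 + B / 2) powr beta0"
        using B2 r by (intro add_mono mult_left_mono) auto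
      moreover have "(1 + r) * (1 - (1 - s) / 4) = (1 + r) - (1 + r) * (1 - s) / 4"
        by (simp add: right_diff_distrib)
      then have "(1 + r) * (1 - (1 - s) / 4) = (1 + r) - (1 - r) / 4"
        by (simp only: rs(1))
      ultimately show ?thesis by (simp add: diff_divide_distrib)
    next
      case False
      \<comment> \<open>This form separates the linear term \<open>C\<close> from its quadratic
        remainder.\<close>
      have tangent: "1 + beta0 / 2 * (C - C\<^sup>2 / (2 + C)) \<le> (1 + C / 2) powr beta0" if "C \<ge> - 1" for C
      proof -
        have "C / 2 / (1 + C / 2) = (C - C\<^sup>2 / (2 + C)) / 2"
          using that by (simp add: divide_simps power2_eq_square) (simp add: algebra_simps)
        then show ?thesis
          using one_plus_powr_ge_tangent[of "C / 2"] that
          by (simp only: times_divide_eq_left times_divide_eq_right)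
      qed
      define q FA FB where "q = r\<^sup>2 / (1 + r)" and "FA = A - A\<^sup>2 / (2 + A)" and "FB = B - B\<^sup>2 / (2 + B)"
      have q: "r\<^sup>2 = (1 + r) * q" "(1 + r) * s\<^sup>2 = 4 * q"
        unfolding rs3 using r by (simp_all add: q_def)
      have "B \<le> 2 * r"
        using log2_complement_ge[of r] r False by (simp add: B_def)
      then have "B / (2 + B) \<le> r / (1 + r)"
        using B r by (simp add: pos_divide_le_eq pos_le_divide_eq algebra_simps)
      then have "B * (B / (2 + B)) \<le> 2 * r * (r / (1 + r))"
        using \<open>B \<le> 2 * r\<close> B r by (intro mult_mono) auto
      then have BB: "B - 2 * q \<le> FB"
        by (simp add: FB_def q_def power2_eq_square)
      have AA: "s\<^sup>2 - log 2 (1 + r) \<le> FA"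
        using powr_seven_quarters_ge[OF s A1] A s74 by (simp add: A_def' FA_def)
      \<comment> \<open>The gain \<open>(1 + r) * s\<^sup>2 = 4 * q\<close> pays exactly for the
        remainder \<open>(1 - r) * (2 * q)\<close> of \<open>B\<close> and the bound
        \<open>2 * r\<^sup>2 = 2 * (1 + r) * q\<close> on the entropy deficit.\<close>
      have "0 = 4 * q - (1 - r) * (2 * q) - 2 * ((1 + r) * q)"
        by (simp add: algebra_simps)
      also have "\<dots> = (1 + r) * s\<^sup>2 - (1 - r) * (2 * q) - 2 * r\<^sup>2"
        by (simp only: q)
      also have "\<dots> \<le> (1 + r) * s\<^sup>2 - (1 - r) * (2 * q)
          - ((1 + r) * log 2 (1 + r) + (1 - r) * log 2 (1 - r))"
        using entropy_deficit_le[of r] r False by simp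
      also have "\<dots> = (1 + r) * (s\<^sup>2 - log 2 (1 + r)) + (1 - r) * (B - 2 * q)"
        unfolding B_def by (simp only: right_diff_distrib)
      also have "\<dots> \<le> (1 + r) * FA + (1 - r) * FB"
        using AA BB r by (intro add_mono mult_left_mono) auto
      finally have "0 \<le> beta0 / 2 * ((1 + r) * FA + (1 - r) * FB)"
        by simp
      moreover have "(1 + r) * (1 + c * FA) + (1 - r) * (1 + c * FB) = 2 + c * ((1 + r) * FA + (1 - r) * FB)"
        for c by (simp add: algebra_simps)
      ultimately have "2 \<le> (1 + r) * (1 + beta0 / 2 * FA) + (1 - r) * (1 + beta0 / 2 * FB)"
        by (metis le_add_same_cancel1)
      also have "\<dots> \<le> (1 + r) * (1 + A / 2) powr beta0 + (1 - r) * (1 + B / 2) powr beta0"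
        unfolding FA_def FB_def using r Am1 B by (intro add_mono mult_left_mono tangent) auto
      finally show ?thesis .
    qed
  qed
qed

section \<open>The l^p norm of a pair, \<open>p = 1 / beta0\<close>, and its supporting
  functionals\<close>

definition powr_norm :: "real \<Rightarrow> real \<Rightarrow> real" where
  "powr_norm c d = (c powr (1 / beta0) + d powr (1 / beta0)) powr beta0"

lemma powr_inverse_beta0 [simp]:
  "c \<ge> 0 \<Longrightarrow> (c powr beta0) powr (1 / beta0) = c"
  "c \<ge> 0 \<Longrightarrow> (c powr (1 / beta0)) powr beta0 = c"
  by (simp_all add: powr_powr)

lemma powr_norm_scale:
  assumes "a \<ge> 0" "u \<ge> 0" "v \<ge> 0"
  shows "powr_norm (a * u powr beta0) (a * v) = a * (u + v powr (1 / beta0)) powr beta0"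
proof -
  have "powr_norm (a * u powr beta0) (a * v) = (a powr (1 / beta0) * (u + v powr (1 / beta0))) powr beta0"
    using assms by (simp add: powr_norm_def powr_mult distrib_left)
  also have "\<dots> = a * (u + v powr (1 / beta0)) powr beta0"
    using assms by (subst powr_mult) simp
  finally show ?thesis .
qed

lemma powr_norm_mono:
  assumes "0 \<le> c" "c \<le> c'" "0 \<le> d" "d \<le> d'"
  shows "powr_norm c d \<le> powr_norm c' d'"
  unfolding powr_norm_def using assms by (intro powr_mono2 add_mono) auto

text \<open>The equality case of \<open>powr_dual_le\<close>: \<open>l\<close> and \<open>k\<close>
  are the coefficients of a supporting functional of the norm at \<open>(P, S)\<close>. The final
  inequality can be summed over the points of the cube.\<close>

lemma powr_norm_dual:
  assumes "0 \<le> P" "0 \<le> S" "0 < P + S"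
  obtains l k where "0 \<le> l" "l \<le> 1" "0 \<le> k" "l * P + k * S = powr_norm P S"
    "\<And>f g. 0 \<le> f \<Longrightarrow> 0 \<le> g \<Longrightarrow> l * f powr beta0 + k * g powr beta0 \<le> (f + g) powr beta0"
proof -
  define X Y where "X = P powr (1 / beta0)" and "Y = S powr (1 / beta0)"
  have XY: "0 \<le> X" "0 \<le> Y"
    by (auto simp: X_def Y_def)
  have pos: "0 < X + Y"
  proof (cases "P = 0")
    case True
    then have "0 < Y" using assms by (simp add: Y_def)
    then show ?thesis using XY by simp
  next
    case False
    then have "0 < X" by (simp add: X_def)
    then show ?thesis using XY by simp
  qed
  define l k where "l = (X / (X + Y)) powr (1 - beta0)" and "k = (Y / (X + Y)) powr (1 - beta0)"
  have split: "(X' / (X + Y)) powr (1 - beta0) * X' powr beta0 = X' / (X + Y) * (X + Y) powr beta0"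
    if "0 \<le> X'" for X'
  proof (cases "X' = 0")
    case False
    have "(X' / (X + Y)) powr (1 - beta0) = (X' / (X + Y)) / (X' powr beta0 / (X + Y) powr beta0)"
      using that pos False by (simp add: powr_diff powr_divide)
    then show ?thesis using that False by simp
  qed simp
  have "l * P + k * S = l * X powr beta0 + k * Y powr beta0"
    using assms by (simp add: X_def Y_def)
  also have "\<dots> = (X / (X + Y) + Y / (X + Y)) * (X + Y) powr beta0"
    using XY by (simp add: l_def k_def split distrib_right)
  also have "\<dots> = powr_norm P S"
    using pos by (simp add: powr_norm_def X_def Y_def flip: add_divide_distrib)
  finally have "l * P + k * S = powr_norm P S" .
  moreover have "l \<le> 1"
    using XY pos by (auto simp: l_def intro!: powr_le1)
  moreover have "l * f powr beta0 + k * g powr beta0 \<le> (f + g) powr beta0"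
    if "0 \<le> f" "0 \<le> g" for f g
    using powr_dual_le[of X Y f g beta0] that XY pos by (simp add: l_def k_def)
  ultimately show thesis
    using that[of l k] by (simp add: l_def k_def)
qed

text \<open>The supporting functional at \<open>(c', d)\<close> has weight \<open>l <= 1\<close> on
  the first entry, so the norm grows no faster than that entry.\<close>

lemma powr_norm_diff_antimono:
  assumes "0 \<le> c" "c \<le> c'" "0 \<le> d"
  shows "powr_norm c' d - c' \<le> powr_norm c d - c"
proof (cases "0 < c' + d")
  case True
  have c': "0 \<le> c'" using assms by simp
  obtain l k where lk: "0 \<le> l" "l \<le> 1" "l * c' + k * d = powr_norm c' d"
    "\<And>f g. 0 \<le> f \<Longrightarrow> 0 \<le> g \<Longrightarrow> l * f powr beta0 + k * g powr beta0 \<le> (f + g) powr beta0"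
    by (rule powr_norm_dual[OF c' assms(3) True]) blast
  have "l * c + k * d \<le> powr_norm c d"
    using lk(4)[of "c powr (1 / beta0)" "d powr (1 / beta0)"] assms by (simp add: powr_norm_def)
  moreover have "l * (c' - c) \<le> 1 * (c' - c)"
    using lk assms by (intro mult_right_mono) auto
  ultimately show ?thesis
    using lk(3) by (simp add: algebra_simps)
next
  case False
  then have "c = c'" using assms by simp
  then show ?thesis by simp
qed

text \<open>
  After division by \<open>m * w powr beta0\<close>, where \<open>m\<close> is the midpoint and \<open>w = log 2 (1 / m) \<ge> 2\<close>, the right-hand
  side is a concave function of \<open>1 / w\<close> with the required value 2 at \<open>1 / w = 0\<close>; hence only \<open>w = 2\<close> matters.
\<close>

lemma two_point_tlog:
  assumes "0 \<le> y" "y \<le> x" "x + y \<le> 1/2"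
  shows "2 * t_log_pow beta0 ((x + y) / 2)
    \<le> powr_norm (t_log_pow beta0 x) (x - y) + t_log_pow beta0 y"
proof (cases "y = 0")
  case True
  show ?thesis
  proof (cases "x = 0")
    case False
    then have x: "0 < x" "x \<le> 1/2" using True assms by auto
    \<comment> \<open>For \<open>y = 0\<close> equality holds: halving \<open>x\<close> adds 1 to
      the logarithm.\<close>
    have "log 2 (2 / x) = 1 + log 2 (1 / x)" "0 \<le> log 2 (1 / x)"
      using x by (simp_all add: log_divide)
    then show ?thesis
      using True x powr_norm_scale[of x "log 2 (1 / x)" 1] by (simp add: t_log_pow_def add.commute)
  qed (use True in \<open>auto simp: t_log_pow_def powr_norm_def\<close>)
next
  case False
  define m r where "m = (x + y) / 2" and "r = (x - y) / (x + y)"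
  have pos: "0 < y" "0 < x" "0 < m" "m \<le> 1/4"
    using False assms by (auto simp: m_def)
  have r: "0 \<le> r" "r < 1" and xy: "x = m * (1 + r)" "y = m * (1 - r)"
    using pos assms by (auto simp: r_def m_def field_simps)
  have xs: "x - y = x * (2 * r / (1 + r))"
  proof -
    have "x * (2 * r / (1 + r)) = m * (2 * r)" using r by (simp add: xy)
    moreover have "x - y = m * (2 * r)" by (simp add: xy algebra_simps)
    ultimately show ?thesis by simp
  qed
  define w where "w = log 2 (1 / m)"
  have "log 2 (2 ^ 2) \<le> w"
    unfolding w_def using pos by (subst log_le_cancel_iff) (auto simp: field_simps)
  then have w: "2 \<le> w" by (subst (asm) log_nat_power) auto
  define A where "A = (2 * r / (1 + r)) powr (1 / beta0) - log 2 (1 + r)"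
  define B where "B = - log 2 (1 - r)"
  note q = two_point_at_quarter[OF r, folded A_def B_def]
  \<comment> \<open>Concavity on the segment from \<open>1\<close> to \<open>1 + C / 2\<close>, with
    weight \<open>2 / w <= 1\<close> on the latter.\<close>
  have scale: "(1 + C / 2) powr beta0 * (2 / w) + (1 - 2 / w) \<le> (1 + C / w) powr beta0" if "-1 \<le> C" for C
  proof -
    have "2 / w * (1 + C / 2) + (1 - 2 / w) * 1 = 1 + C / w"
      using w by (simp add: field_simps)
    then show ?thesis
      using powr_concave_combination[of "1 + C / 2" 1 "2 / w" "1 - 2 / w" beta0] w that
      by (simp only: mult.commute[of "2 / w"]) simp
  qed
  have logx: "log 2 (1 / x) = w - log 2 (1 + r)" and logy: "log 2 (1 / y) = w + B"
  proof -
    have "log 2 (m * (1 + r)) = log 2 m + log 2 (1 + r)" "log 2 (m * (1 - r)) = log 2 m + log 2 (1 - r)"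
      using pos r by (auto simp: log_mult)
    moreover have "log 2 (1 / c) = - log 2 c" for c :: real
      by (simp add: log_def ln_div)
    ultimately show "log 2 (1 / x) = w - log 2 (1 + r)" "log 2 (1 / y) = w + B"
      by (simp_all only: w_def B_def xy)
  qed
  have "log 2 (1 + r) \<le> log 2 2"
    using r by (subst log_le_cancel_iff) auto
  then have logr: "log 2 (1 + r) \<le> 1" by simp
  have pw: "(w + C) powr beta0 = w powr beta0 * (1 + C / w) powr beta0" for C
  proof -
    have "w + C = w * (1 + C / w)" using w by (simp add: distrib_left)
    then show ?thesis by (simp only: powr_mult)
  qed
  have "2 * t_log_pow beta0 ((x + y) / 2) = m * w powr beta0 * 2"
    by (simp add: t_log_pow_def w_def m_def)
  also have "\<dots> \<le> m * w powr beta0 * ((1 + r) * (1 + A / w) powr beta0 + (1 - r) * (1 + B / w) powr beta0)"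
  proof (intro mult_left_mono)
    have comb: "((1 + r) * X + (1 - r) * Y) * e + 2 * (1 - e)
        = (1 + r) * (X * e + (1 - e)) + (1 - r) * (Y * e + (1 - e))" for X Y e :: real
      by (simp add: algebra_simps)
    have "2 = 2 * (2 / w) + 2 * (1 - 2 / w)" using w by (simp add: field_simps)
    also have "\<dots> \<le> ((1 + r) * (1 + A / 2) powr beta0 + (1 - r) * (1 + B / 2) powr beta0) * (2 / w)
        + 2 * (1 - 2 / w)"
      using q(3) w by (intro add_mono mult_right_mono) auto
    also have "\<dots> = (1 + r) * ((1 + A / 2) powr beta0 * (2 / w) + (1 - 2 / w))
        + (1 - r) * ((1 + B / 2) powr beta0 * (2 / w) + (1 - 2 / w))"
      by (rule comb)
    also have "\<dots> \<le> (1 + r) * (1 + A / w) powr beta0 + (1 - r) * (1 + B / w) powr beta0"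
      using q(1,2) r by (intro add_mono mult_left_mono scale) auto
    finally show "2 \<le> (1 + r) * (1 + A / w) powr beta0 + (1 - r) * (1 + B / w) powr beta0" .
  qed (use pos in auto)
  also have "\<dots> = x * (w + A) powr beta0 + y * (w + B) powr beta0"
  proof -
    have "m * W * ((1 + r) * X + (1 - r) * Y) = m * (1 + r) * (W * X) + m * (1 - r) * (W * Y)"
      for W X Y :: real by (simp add: algebra_simps)
    then show ?thesis by (simp only: pw xy)
  qed
  also have "x * (w + A) powr beta0 = powr_norm (t_log_pow beta0 x) (x - y)"
  proof -
    have eq: "w + A = log 2 (1 / x) + (2 * r / (1 + r)) powr (1 / beta0)"
      by (simp only: logx A_def)
    have "0 \<le> log 2 (1 / x)"
      unfolding logx using w logr by linarith
    moreover have "0 \<le> 2 * r / (1 + r)"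
      using r by simp
    ultimately show ?thesis
      unfolding xs t_log_pow_def eq using pos(2) by (intro powr_norm_scale[symmetric]) auto
  qed
  also have "y * (w + B) powr beta0 = t_log_pow beta0 y"
    by (simp add: t_log_pow_def logy)
  finally show ?thesis by simp
qed

section \<open>The two-point inequality for the quadratic profile\<close>

definition quad :: "real \<Rightarrow> real" where
  "quad x = 2 * x * (1 - x)"

text \<open>Since \<open>2 * quad ((x + y) / 2) = quad x + (x - y)\<^sup>2 + quad y\<close>, the
  task is to bound \<open>V\<close> below by \<open>quad x + (x - y)\<^sup>2\<close>. The second
  bound gives this if \<open>y <= 2 * x - 1\<close>; otherwise
  \<open>x - y <= quad x <= 1/2\<close>, and the first does, as
  \<open>1 / beta0 <= 2\<close>.\<close>

lemma two_point_quad: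
  assumes "0 \<le> y" "y \<le> x" "x \<le> 1"
    and V: "powr_norm (quad x) (x - y) \<le> V" "(x - y) + quad x / 2 \<le> V"
  shows "2 * quad ((x + y) / 2) \<le> V + quad y"
proof (cases "y \<le> 2 * x - 1")
  case True
  then have "0 \<le> y * (2 * x - 1 - y)" using assms by simp
  then show ?thesis using V(2) by (simp add: quad_def field_simps)
next
  case False
  define k where "k = quad x"
  have eq: "2 * quad ((x + y) / 2) = k + (x - y)\<^sup>2 + quad y"
    by (simp add: quad_def k_def power2_eq_square field_simps)
  have k12: "k \<le> 1/2"
    using zero_le_power2[of "x - 1/2"] by (simp add: k_def quad_def power2_eq_square algebra_simps)
  have dk: "x - y \<le> k"
  proof (cases "x \<le> 1/2")
    case True
    then have "x * 1 \<le> x * (2 * (1 - x))"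
      using assms by (intro mult_left_mono) auto
    then show ?thesis using assms by (simp add: k_def quad_def algebra_simps)
  next
    case False
    then have "1 * (1 - x) \<le> 2 * x * (1 - x)"
      using assms by (intro mult_right_mono) auto
    then have "1 - x \<le> k" by (simp add: k_def quad_def)
    then show ?thesis using \<open>\<not> y \<le> 2 * x - 1\<close> by simp
  qed
  show ?thesis
  proof (cases "k > 0")
    case True
    define u where "u = (x - y) / k"
    have u: "0 \<le> u" "u \<le> 1" "x - y = k * u"
      using True dk assms by (auto simp: u_def)
    have "k + (x - y)\<^sup>2 = k * (1 + k * u\<^sup>2)"
      by (simp add: u power2_eq_square algebra_simps)
    also have "\<dots> \<le> k * (1 + 1/2 * u\<^sup>2)"
      using True k12 by (intro mult_left_mono add_left_mono mult_right_mono) auto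
    also have "\<dots> \<le> k * (1 + u\<^sup>2) powr beta0"
      using True u one_plus_powr_ge[of "u\<^sup>2"] by (intro mult_left_mono) (auto simp: power_le_one)
    also have "\<dots> \<le> k * (1 + u powr (1 / beta0)) powr beta0"
      using powr_mono'[of "1 / beta0" 2 u] inverse_beta0_bounds u True
      by (intro mult_left_mono powr_mono2) auto
    also have "\<dots> = powr_norm k (x - y)"
      using powr_norm_scale[of k 1 u] u True by simp
    finally show ?thesis using eq V(1) by (simp add: k_def)
  next
    case False
    then have "x - y = 0" using dk assms by simp
    moreover have "0 \<le> V"
      using V(1) by (rule order_trans[rotated]) (simp add: powr_norm_def)
    ultimately show ?thesis using eq False by simp
  qed
qed

subsection \<open>The isoperimetric profile\<close>

text \<open>
  Equality holds at both ends. The difference of logarithms \<open>g\<close> increases and then decreases, because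
  the sign of its derivative is that of the concave function \<open>\<psi>\<close>, and \<open>\<psi> 0 > 0\<close>.
\<close>

lemma tlog_le_quad:
  assumes "1/4 \<le> x" "x \<le> 1/2"
  shows "t_log_pow beta0 x \<le> quad x"
proof -
  \<comment> \<open>With \<open>x = 2 powr (- 1 - t)\<close> the claim is
    \<open>(1 + t) powr beta0 <= 2 - 2 powr (- t)\<close>, that is, \<open>0 <= g t\<close>.\<close>
  define g where "g = (\<lambda>t::real. ln (2 - 2 powr (- t)) - beta0 * ln (1 + t))"
  define \<psi> where "\<psi> = (\<lambda>t::real. ln 2 * (1 + t) - beta0 * (2 * 2 powr t - 1))"
  have pos: "0 < 2 * 2 powr t - 1" "0 < 2 - 2 powr (- t)" if "0 \<le> t" for t :: real
  proof -
    show "0 < 2 * 2 powr t - 1" using ge_one_powr_ge_zero[of 2 t] that by simp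
    show "0 < 2 - 2 powr (- t)" using powr_mono[of "- t" 0 2] that by simp
  qed
  have deriv: "(g has_real_derivative \<psi> t / ((2 * 2 powr t - 1) * (1 + t))) (at t)" if "0 \<le> t" for t
  proof -
    have "(g has_real_derivative ln 2 * 2 powr (- t) / (2 - 2 powr (- t)) - beta0 / (1 + t)) (at t)"
      unfolding g_def using that pos(2)[OF that]
      by (auto intro!: derivative_eq_intros)
    also have "ln 2 * 2 powr (- t) / (2 - 2 powr (- t)) = ln 2 / (2 * 2 powr t - 1)"
      using pos[OF that] by (simp add: powr_minus field_simps)
    also have "ln 2 / (2 * 2 powr t - 1) - beta0 / (1 + t) = \<psi> t / ((2 * 2 powr t - 1) * (1 + t))"
      using pos[OF that] that by (simp add: \<psi>_def diff_frac_eq)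
    finally show ?thesis .
  qed
  define g' where "g' t = \<psi> t / ((2 * 2 powr t - 1) * (1 + t))" for t
  note deriv = deriv[folded g'_def]
  have sign: "sgn (g' t) = sgn (\<psi> t)" if "0 \<le> t" for t
    using pos(1)[OF that] that by (simp add: g'_def sgn_mult sgn_divide)
  have "g 0 = 0" by (simp add: g_def)
  have "g 1 = 0" by (simp add: g_def beta0_def log_def powr_minus)
  \<comment> \<open>A negative value between the zeros of \<open>g\<close> would give
    \<open>0 < a < b\<close> with \<open>\<psi> a < 0 < \<psi> b\<close>, but by concavity
    \<open>\<psi> a\<close> is at least the chord value between \<open>\<psi> 0 > 0\<close> and
    \<open>\<psi> b\<close>.\<close>
  have g_nonneg: "0 \<le> g t" if t: "0 \<le> t" "t \<le> 1" for t
  proof (rule ccontr)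
    assume neg: "\<not> 0 \<le> g t"
    then have t': "0 < t" "t < 1"
      using t \<open>g 0 = 0\<close> \<open>g 1 = 0\<close> by (auto simp: order_less_le)
    obtain a where a: "0 < a" "a < t" "g t - g 0 = (t - 0) * g' a"
    proof -
      have "(g has_real_derivative g' z) (at z)" if "0 \<le> z" for z
        using that by (rule deriv)
      then show thesis using MVT2[OF t'(1), of g g'] that by blast
    qed
    obtain b where b: "t < b" "b < 1" "g 1 - g t = (1 - t) * g' b"
    proof -
      have "(g has_real_derivative g' z) (at z)" if "t \<le> z" for z
        using that t' by (intro deriv) auto
      then show thesis using MVT2[OF t'(2), of g g'] that by blast
    qed
    have "g' a < 0"
      using a(3) neg t' \<open>g 0 = 0\<close> by (simp add: not_le mult_less_0_iff)
    then have \<psi>a: "\<psi> a < 0"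
      using sign[of a] a by (simp add: sgn_if split: if_splits)
    have "0 < (1 - t) * g' b"
      using b(3) neg \<open>g 1 = 0\<close> by simp
    then have "0 < g' b"
      using t' by (simp add: zero_less_mult_iff)
    then have \<psi>b: "0 < \<psi> b"
      using sign[of b] b t' by (simp add: sgn_if split: if_splits)
    have \<psi>0: "0 < \<psi> 0"
      using ln2_ge_two_thirds beta0_bounds by (simp add: \<psi>_def)
    define l where "l = a / b"
    have l: "0 < l" "l < 1" "a = l * b" using a b t' by (auto simp: l_def)
    have "2 powr a \<le> (1 - l) + l * 2 powr b"
      using powr_one_sub_mult_le[of 1 "2 powr b" l] l by (simp add: powr_powr mult.commute)
    then have "beta0 * 2 powr a \<le> beta0 * ((1 - l) + l * 2 powr b)"
      by (intro mult_left_mono) auto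
    then have "(1 - l) * \<psi> 0 + l * \<psi> b \<le> \<psi> a"
      by (simp add: \<psi>_def l(3) algebra_simps)
    moreover have "0 < (1 - l) * \<psi> 0 + l * \<psi> b"
      using l \<psi>0 \<psi>b by (intro add_pos_pos mult_pos_pos) auto
    ultimately show False using \<psi>a by simp
  qed
  define t where "t = log 2 (1 / x) - 1"
  have "log 2 2 \<le> log 2 (1 / x)" "log 2 (1 / x) \<le> log 2 (2 ^ 2)"
    using assms by (auto simp: field_simps)
  moreover have "log 2 ((2::real) ^ 2) = 2" by (subst log_nat_power) auto
  ultimately have t: "0 \<le> t" "t \<le> 1" by (simp_all add: t_def)
  have x: "2 powr (- t) = 2 * x"
    using assms by (simp add: t_def powr_diff powr_minus)
  have "ln ((1 + t) powr beta0) \<le> ln (2 - 2 * x)"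
    using g_nonneg[OF t] by (simp add: g_def x)
  then have "(1 + t) powr beta0 \<le> 2 - 2 * x"
    using assms t by (subst (asm) ln_le_cancel_iff) auto
  then have "x * (1 + t) powr beta0 \<le> x * (2 - 2 * x)"
    using assms by (intro mult_left_mono) auto
  then show ?thesis
    by (simp add: t_log_pow_def quad_def t_def algebra_simps)
qed

text \<open>Passing from \<open>x\<close> down to \<open>y\<close> multiplies the power factor by at
  most \<open>1 + c / 2 <= x / y\<close>, because \<open>w >= 2\<close> and
  \<open>beta0 <= 1\<close>.\<close>

lemma tlog_mono:
  assumes "0 \<le> y" "y \<le> x" "x \<le> 1/4"
  shows "t_log_pow beta0 y \<le> t_log_pow beta0 x"
proof (cases "y = 0")
  case True
  then show ?thesis using assms by (simp add: t_log_pow_def)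
next
  case False
  define w c where "w = log 2 (1 / x)" and "c = log 2 (x / y)"
  have pos: "0 < y" "0 < x" using False assms by auto
  have "log 2 (2 ^ 2) \<le> w"
    unfolding w_def using pos assms by (subst log_le_cancel_iff) (auto simp: field_simps)
  then have w: "2 \<le> w" by (subst (asm) log_nat_power) auto
  have c: "0 \<le> c" "c \<le> 2 * (x / y - 1)"
    unfolding c_def using log2_le[of "x / y"] pos assms by auto
  have "log 2 (1 / y) = w + c"
    using pos by (simp add: w_def c_def log_divide)
  then have "t_log_pow beta0 y = y * (w + c) powr beta0"
    by (simp add: t_log_pow_def)
  also have "\<dots> = y * (w powr beta0 * (1 + c / w) powr beta0)"
    using w by (simp add: distrib_left flip: powr_mult)
  also have "\<dots> \<le> y * (w powr beta0 * (x / y))"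
  proof (intro mult_left_mono)
    have "(1 + c / w) powr beta0 \<le> (1 + c / w) powr 1"
      using c w by (intro powr_mono) auto
    also have "\<dots> \<le> 1 + c / 2"
      using c w frac_le[of c c 2 w] by simp
    also have "\<dots> \<le> x / y" using c by simp
    finally show "(1 + c / w) powr beta0 \<le> x / y" .
  qed (use pos in auto)
  also have "\<dots> = t_log_pow beta0 x"
    using pos by (simp add: t_log_pow_def w_def)
  finally show ?thesis .
qed

text \<open>The logarithmic branch stops at 1/4 because \<open>two_point_tlog\<close> covers
  midpoints up to 1/4; from there to 1/2, \<open>quad\<close> dominates by
  \<open>tlog_le_quad\<close>.\<close>

definition isop :: "real \<Rightarrow> real" where
  "isop x = (if star x \<le> 1/4 then max (quad x) (t_log_pow beta0 (star x)) else quad x)"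

lemma star_complement [simp]: "star (1 - x) = star x"
  by (simp add: star_def min.commute)

lemma isop_complement [simp]: "isop (1 - x) = isop x"
  by (simp add: isop_def quad_def mult_ac)

lemma isop_0 [simp]: "isop 0 = 0" and isop_1 [simp]: "isop 1 = 0"
  by (simp_all add: isop_def quad_def star_def t_log_pow_def)

lemma quad_le_isop: "quad x \<le> isop x"
  by (simp add: isop_def)

lemma isop_nonneg: "0 \<le> x \<Longrightarrow> x \<le> 1 \<Longrightarrow> 0 \<le> isop x"
  by (rule order_trans[OF _ quad_le_isop]) (simp add: quad_def)

lemma tlog_star_le_isop: "t_log_pow beta0 (star x) \<le> isop x"
proof (cases "star x \<le> 1/4")
  case False
  then have "t_log_pow beta0 (star x) \<le> quad (star x)"
    by (intro tlog_le_quad) (auto simp: star_def min_def)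
  also have "quad (star x) = quad x"
    by (simp add: quad_def star_def min_def)
  finally show ?thesis by (simp add: isop_def)
qed (simp add: isop_def)

text \<open>Both branches increase; for \<open>y <= 1/4 < x\<close> the comparison passes through
  \<open>t_log_pow beta0 (1/4) <= quad (1/4)\<close>.\<close>

lemma isop_mono:
  assumes "0 \<le> y" "y \<le> x" "x \<le> 1/2"
  shows "isop y \<le> isop x"
proof -
  have star: "star x = x" "star y = y" using assms by (simp_all add: star_def)
  have quad: "quad u \<le> quad v" if "u \<le> v" "v \<le> 1/2" for u v
  proof -
    have "0 \<le> (v - u) * (1 - u - v)" using that by simp
    then show ?thesis by (simp add: quad_def algebra_simps)
  qed
  have "t_log_pow beta0 y \<le> isop x" if y: "y \<le> 1/4"
  proof (cases "x \<le> 1/4")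
    case True
    then show ?thesis
      using tlog_mono[OF assms(1,2)] tlog_star_le_isop[of x] star by simp
  next
    case False
    have "t_log_pow beta0 y \<le> quad (1/4)"
      using tlog_mono[OF assms(1) y] tlog_le_quad[of "1/4"] by simp
    also have "\<dots> \<le> quad x" using quad False assms by simp
    finally show ?thesis using quad_le_isop[of x] by simp
  qed
  moreover have "quad y \<le> isop x"
    using quad[of y x] quad_le_isop[of x] assms by simp
  ultimately show ?thesis
    by (subst isop_def) (simp add: star)
qed

text \<open>
  If the midpoint is at least \<open>3/4\<close>, reflect \<open>(x, y)\<close> to \<open>(1 - y, 1 - x)\<close>: the gain from the first
  argument of \<open>powr_norm\<close> is larger for the smaller of \<open>isop x\<close> and \<open>isop y\<close>.
\<close>

lemma two_point_isop:
  assumes "0 \<le> y" "y \<le> x" "x \<le> 1"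
    and V: "powr_norm (isop x) (x - y) \<le> V" "(x - y) + isop x / 2 \<le> V"
  shows "2 * isop ((x + y) / 2) \<le> V + isop y"
proof -
  define m where "m = (x + y) / 2"
  have qx: "0 \<le> quad x" using assms by (simp add: quad_def)
  have "2 * quad m \<le> V + quad y"
    unfolding m_def
  proof (rule two_point_quad)
    show "powr_norm (quad x) (x - y) \<le> V"
      using V(1) powr_norm_mono[OF qx quad_le_isop[of x], of "x - y" "x - y"] assms by simp
    show "x - y + quad x / 2 \<le> V"
      using V(2) quad_le_isop[of x] by simp
  qed (use assms in auto)
  then have "2 * quad m \<le> V + isop y"
    using quad_le_isop[of y] by simp
  moreover have "2 * t_log_pow beta0 (star m) \<le> V + isop y" if "star m \<le> 1/4"
  proof (cases "m \<le> 1/4")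
    case True
    have nn: "0 \<le> t_log_pow beta0 x" using assms by (simp add: t_log_pow_def)
    have star: "star x = x" "star y = y" "star m = m"
      using True assms by (auto simp: star_def m_def min_def field_simps)
    have "2 * t_log_pow beta0 m \<le> powr_norm (t_log_pow beta0 x) (x - y) + t_log_pow beta0 y"
      unfolding m_def using True assms by (intro two_point_tlog) (auto simp: m_def)
    also have "\<dots> \<le> powr_norm (isop x) (x - y) + isop y"
      using tlog_star_le_isop[of x] tlog_star_le_isop[of y] nn assms
      by (intro add_mono powr_norm_mono) (auto simp: star)
    finally show ?thesis using V(1) star by simp
  next
    case False
    then have m: "3/4 \<le> m" using that by (auto simp: star_def min_def split: if_splits)
    then have star: "star x = 1 - x" "star y = 1 - y" "star m = 1 - m"
      using assms by (auto simp: star_def m_def min_def field_simps)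
    have nn: "0 \<le> t_log_pow beta0 (1 - y)" using assms by (simp add: t_log_pow_def)
    have "2 * t_log_pow beta0 (1 - m)
        \<le> powr_norm (t_log_pow beta0 (1 - y)) (x - y) + t_log_pow beta0 (1 - x)"
      using two_point_tlog[of "1 - x" "1 - y"] m assms by (simp add: m_def field_simps)
    also have "\<dots> \<le> powr_norm (isop y) (x - y) + isop x"
      using tlog_star_le_isop[of x] tlog_star_le_isop[of y] nn assms
      by (intro add_mono powr_norm_mono) (auto simp: star)
    also have "\<dots> \<le> powr_norm (isop x) (x - y) + isop y"
    proof -
      have "isop x \<le> isop y"
        using isop_mono[of "1 - x" "1 - y"] m assms by (simp add: m_def)
      then show ?thesis
        using powr_norm_diff_antimono[of "isop x" "isop y" "x - y"] isop_nonneg[of x] assms by simp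
    qed
    finally show ?thesis using V(1) star by simp
  qed
  ultimately show ?thesis
    unfolding m_def[symmetric] by (subst isop_def) (simp add: max_def)
qed

subsection \<open>The induction on the dimension\<close>

lemma finite_hypercube [simp]: "finite (hypercube n)"
  by (auto simp: hypercube_def intro!: finite_PiE)

lemma card_hypercube: "card (hypercube n) = 2 ^ n"
  by (simp add: hypercube_def card_PiE numeral_2_eq_2)

lemma hypercube_iff:
  "x \<in> hypercube n \<longleftrightarrow> (\<forall>i<n. x i = 0 \<or> x i = 1) \<and> (\<forall>i\<ge>n. x i = undefined)"
  by (auto simp: hypercube_def PiE_iff extensional_def)

lemma hypercube_flip:
  assumes "x \<in> hypercube n" "i < n"
  shows "x(i := 1 - x i) \<in> hypercube n"
  using assms by (auto simp: hypercube_iff)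

lemma hypercube_value:
  assumes "x \<in> hypercube n" "i < n"
  shows "x i = 0 \<or> x i = 1"
  using assms by (auto simp: hypercube_iff)

lemma flip_inj:
  assumes "x \<in> hypercube n" "i < n" "x(i := 1 - x i) = x(j := 1 - x j)"
  shows "i = j"
proof (rule ccontr)
  assume "i \<noteq> j"
  then have "1 - x i = x i"
    using fun_cong[OF assms(3), of i] by simp
  then show False
    using hypercube_value[OF assms(1,2)] by auto
qed

lemma adjacent_flip:
  assumes "x \<in> hypercube n" "i < n"
  shows "adjacent n x (x(i := 1 - x i))"
  using assms hypercube_flip[OF assms] hypercube_value[OF assms]
  by (auto simp: adjacent_def)

lemma adjacentE:
  assumes "adjacent n x y"
  obtains i where "i < n" "y = x(i := 1 - x i)"
proof -
  from assms obtain i where i: "i < n" "x i \<noteq> y i" and uniq: "\<And>j. j < n \<Longrightarrow> x j \<noteq> y j \<Longrightarrow> j = i"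
    unfolding adjacent_def by blast
  have xy: "x \<in> hypercube n" "y \<in> hypercube n"
    using assms by (auto simp: adjacent_def)
  have "y j = (x(i := 1 - x i)) j" for j
  proof (cases "j < n")
    case True
    have "y i = 1 - x i"
      using i(2) hypercube_value[OF xy(1) i(1)] hypercube_value[OF xy(2) i(1)] by linarith
    moreover have "y j = x j" if "j \<noteq> i"
      using uniq[of j] True that by metis
    ultimately show ?thesis by simp
  next
    case False
    then show ?thesis
      using xy i(1) by (simp add: hypercube_iff)
  qed
  then have "y = x(i := 1 - x i)" by (rule ext)
  with i(1) show thesis by (rule that)
qed

text \<open>Each neighbour arises from exactly one flip. Counting coordinates lets the last one be
  split off.\<close>

lemma h_eq_card_flips:
  assumes "A \<subseteq> hypercube n" "x \<in> A"
  shows "h n A x = real (card {i. i < n \<and> x(i := 1 - x i) \<notin> A})"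
proof -
  have x: "x \<in> hypercube n" using assms by auto
  have "bij_betw (\<lambda>i. x(i := 1 - x i)) {i. i < n \<and> x(i := 1 - x i) \<notin> A}
      {y \<in> hypercube n - A. adjacent n x y}"
    unfolding bij_betw_def
  proof (intro conjI inj_onI set_eqI iffI)
    show "i = j" if "i \<in> {i. i < n \<and> x(i := 1 - x i) \<notin> A}" "x(i := 1 - x i) = x(j := 1 - x j)" for i j
      using that flip_inj[OF x] by auto
    show "y \<in> {y \<in> hypercube n - A. adjacent n x y}"
      if "y \<in> (\<lambda>i. x(i := 1 - x i)) ` {i. i < n \<and> x(i := 1 - x i) \<notin> A}" for y
      using that hypercube_flip[OF x] adjacent_flip[OF x] by auto
    show "y \<in> (\<lambda>i. x(i := 1 - x i)) ` {i. i < n \<and> x(i := 1 - x i) \<notin> A}"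
      if "y \<in> {y \<in> hypercube n - A. adjacent n x y}" for y
    proof -
      from that obtain i where "i < n" "y = x(i := 1 - x i)"
        by (auto elim: adjacentE)
      then show ?thesis using that by auto
    qed
  qed
  then show ?thesis
    using assms by (simp add: h_def bij_betw_same_card)
qed

section \<open>Slices in the last coordinate\<close>

definition cube_slice :: "nat \<Rightarrow> (nat \<Rightarrow> nat) set \<Rightarrow> nat \<Rightarrow> (nat \<Rightarrow> nat) set" where
  "cube_slice n A a = {x \<in> hypercube n. x(n := a) \<in> A}"

lemma cube_slice_subset: "cube_slice n A a \<subseteq> hypercube n"
  by (auto simp: cube_slice_def)

lemma finite_cube_slice [simp]: "finite (cube_slice n A a)"
  by (rule finite_subset[OF cube_slice_subset]) simp

text \<open>The lifts of the two slices partition \<open>A\<close>; lifting is injective because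
  points of \<open>hypercube n\<close> are \<open>undefined\<close> at \<open>n\<close>.\<close>

lemma sum_cube_slice:
  assumes "A \<subseteq> hypercube (Suc n)"
  shows "sum f A = (\<Sum>x\<in>cube_slice n A 0. f (x(n := 0))) + (\<Sum>x\<in>cube_slice n A 1. f (x(n := 1)))"
proof -
  let ?g = "\<lambda>a x :: nat \<Rightarrow> nat. x(n := a)"
  have "A = ?g 0 ` cube_slice n A 0 \<union> ?g 1 ` cube_slice n A 1"
  proof (intro set_eqI iffI)
    fix z assume z: "z \<in> A"
    then have zc: "z \<in> hypercube (Suc n)" using assms by auto
    have slice: "z(n := undefined) \<in> hypercube n"
      using zc by (auto simp: hypercube_iff)
    have "z n = 0 \<or> z n = 1"
      using zc by (rule hypercube_value) simp
    then have "z = ?g 0 (z(n := undefined)) \<or> z = ?g 1 (z(n := undefined))"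
      by (auto simp: fun_eq_iff)
    then show "z \<in> ?g 0 ` cube_slice n A 0 \<union> ?g 1 ` cube_slice n A 1"
    proof
      assume "z = ?g 0 (z(n := undefined))"
      then show ?thesis
        using slice z by (intro UnI1 image_eqI[of _ _ "z(n := undefined)"]) (auto simp: cube_slice_def)
    next
      assume "z = ?g 1 (z(n := undefined))"
      then show ?thesis
        using slice z by (intro UnI2 image_eqI[of _ _ "z(n := undefined)"]) (auto simp: cube_slice_def)
    qed
  qed (auto simp: cube_slice_def)
  moreover have "?g 0 ` cube_slice n A 0 \<inter> ?g 1 ` cube_slice n A 1 = {}"
    by (auto dest: fun_cong[of _ _ n])
  moreover have inj: "inj_on (?g a) (cube_slice n A a)" for a
  proof (rule inj_onI)
    fix x y assume xy: "x \<in> cube_slice n A a" "y \<in> cube_slice n A a" "x(n := a) = y(n := a)"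
    have "x n = undefined" "y n = undefined"
      using xy by (auto simp: cube_slice_def hypercube_iff)
    then show "x = y"
      using xy(3) by (metis fun_upd_triv fun_upd_upd)
  qed
  ultimately have "sum f A = sum f (?g 0 ` cube_slice n A 0) + sum f (?g 1 ` cube_slice n A 1)"
    by (metis finite_cube_slice finite_imageI sum.union_disjoint)
  then show ?thesis
    by (simp add: sum.reindex[OF inj])
qed

text \<open>Flips below \<open>n\<close> remain in the same slice of the cube; the flip at
  \<open>n\<close> leads to the other one and counts iff it leaves \<open>A\<close>.\<close>

lemma h_cube_slice:
  assumes "A \<subseteq> hypercube (Suc n)" "x \<in> cube_slice n A a" "a \<le> 1"
  shows "h (Suc n) A (x(n := a)) = h n (cube_slice n A a) x + (if x \<in> cube_slice n A (1 - a) then 0 else 1)"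
proof -
  have x: "x \<in> hypercube n" "x(n := a) \<in> A" using assms by (auto simp: cube_slice_def)
  let ?F = "{i. i < n \<and> x(i := 1 - x i) \<notin> cube_slice n A a}"
  have "{i. i < Suc n \<and> (x(n := a))(i := 1 - (x(n := a)) i) \<notin> A}
      = ?F \<union> (if x \<in> cube_slice n A (1 - a) then {} else {n})"
    using x hypercube_flip[OF x(1)]
    by (auto simp: less_Suc_eq cube_slice_def fun_upd_twist[of n])
  moreover have "card (?F \<union> (if x \<in> cube_slice n A (1 - a) then {} else {n}))
      = card ?F + (if x \<in> cube_slice n A (1 - a) then 0 else 1)"
    by auto
  ultimately show ?thesis
    using assms x by (simp add: h_eq_card_flips cube_slice_subset)
qed

text \<open>For \<open>u >= 1\<close> the chord bound at \<open>1 / u\<close> reduces this to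
  \<open>2 <= (u + 1) * u powr (beta0 - 1)\<close>, which follows from
  \<open>u + 1 >= 2 * sqrt u\<close> and \<open>beta0 >= 1/2\<close>. Integrality matters: the
  inequality fails for small positive reals.\<close>

lemma succ_powr_ge:
  "1 + real k powr beta0 / 2 \<le> (real k + 1) powr beta0"
proof (cases "k = 0")
  case False
  define u where "u = real k"
  have u: "1 \<le> u" using False by (simp add: u_def)
  have "u powr beta0 * (1 + (1 / u) / 2) \<le> u powr beta0 * (1 + 1 / u) powr beta0"
    using u by (intro mult_left_mono one_plus_powr_ge) auto
  also have "\<dots> = (u + 1) powr beta0"
    using u by (simp add: distrib_left flip: powr_mult)
  finally have "u powr beta0 + u powr beta0 / u / 2 \<le> (u + 1) powr beta0"
    by (simp add: distrib_left)
  moreover have "1 \<le> u powr (1/2)" using u by (intro ge_one_powr_ge_zero) auto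
  moreover have "2 \<le> u powr beta0 + u powr beta0 / u"
  proof -
    have "0 \<le> (u powr (1/2) - 1)\<^sup>2" by simp
    then have "2 * u powr (1/2) \<le> u + 1"
      using u by (simp add: power2_diff powr_power)
    then have "2 \<le> (u + 1) * u powr (- (1/2))"
      using u by (simp add: powr_minus field_simps)
    also have "\<dots> \<le> (u + 1) * u powr (beta0 - 1)"
      using u beta0_bounds by (intro mult_left_mono powr_mono) auto
    also have "\<dots> = u powr beta0 + u powr beta0 / u"
      using u by (simp add: powr_diff field_simps)
    finally show ?thesis .
  qed
  ultimately show ?thesis
    unfolding u_def[symmetric] by (simp add: field_simps)
qed simp

text \<open>Sums two pointwise bounds over \<open>C\<close>: the functional from
  \<open>powr_norm_dual\<close>, and \<open>succ_powr_ge\<close>.\<close>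

lemma sum_powr_indicator_ge:
  fixes f :: "'a \<Rightarrow> nat"
  assumes "finite C" "M > 0" "0 \<le> P" "M * P \<le> (\<Sum>x\<in>C. real (f x) powr beta0)"
    and "0 \<le> S" "M * S \<le> real (card (C - D))"
  defines "T \<equiv> (\<Sum>x\<in>C. (real (f x) + (if x \<in> D then 0 else 1)) powr beta0)"
  shows "M * powr_norm P S \<le> T" "M * (S + P / 2) \<le> T"
proof -
  have ind: "(\<Sum>x\<in>C. k * (if x \<in> D then 0 else 1)) = k * real (card (C - D))" for k :: real
  proof -
    have "(\<Sum>x\<in>C. k * (if x \<in> D then 0 else 1)) = (\<Sum>x\<in>C - D. k)"
      using assms(1) by (intro sum.mono_neutral_cong_right) auto
    then show ?thesis by simp
  qed
  show "M * powr_norm P S \<le> T"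
  proof (cases "0 < P + S")
    case True
    obtain l k where lk: "0 \<le> l" "l \<le> 1" "0 \<le> k" "l * P + k * S = powr_norm P S"
      "\<And>f g. 0 \<le> f \<Longrightarrow> 0 \<le> g \<Longrightarrow> l * f powr beta0 + k * g powr beta0 \<le> (f + g) powr beta0"
      by (rule powr_norm_dual[OF assms(3,5) True]) blast
    have "M * powr_norm P S = l * (M * P) + k * (M * S)"
      by (simp add: algebra_simps flip: lk(4))
    also have "\<dots> \<le> l * (\<Sum>x\<in>C. real (f x) powr beta0) + k * real (card (C - D))"
      using lk assms by (intro add_mono mult_left_mono) auto
    also have "\<dots> = (\<Sum>x\<in>C. l * real (f x) powr beta0 + k * (if x \<in> D then 0 else 1))"
      by (simp only: sum.distrib sum_distrib_left ind)
    also have "\<dots> \<le> T"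
      unfolding T_def
    proof (rule sum_mono)
      fix x assume "x \<in> C"
      \<comment> \<open>Off \<open>D\<close> the dual bound applies with \<open>g = 1\<close>; on
        \<open>D\<close>, \<open>l <= 1\<close> suffices.\<close>
      show "l * real (f x) powr beta0 + k * (if x \<in> D then 0 else 1)
          \<le> (real (f x) + (if x \<in> D then 0 else 1)) powr beta0"
        using lk(5)[of "real (f x)" 1] lk(1,2) by (auto intro: mult_left_le_one_le)
    qed
    finally show ?thesis .
  next
    case False
    then have "P = 0" "S = 0" using assms by auto
    then show ?thesis by (simp add: T_def powr_norm_def sum_nonneg)
  qed
  have "M * (S + P / 2) = M * S + (M * P) / 2"
    by (simp add: algebra_simps)
  also have "\<dots> \<le> 1 * real (card (C - D)) + (\<Sum>x\<in>C. real (f x) powr beta0) / 2"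
    using assms by simp
  also have "\<dots> = (\<Sum>x\<in>C. 1 * (if x \<in> D then 0 else 1) + real (f x) powr beta0 / 2)"
    by (simp only: sum.distrib sum_divide_distrib ind)
  also have "\<dots> \<le> T"
    unfolding T_def
  proof (rule sum_mono)
    fix x assume "x \<in> C"
    show "1 * (if x \<in> D then 0 else 1) + real (f x) powr beta0 / 2
        \<le> (real (f x) + (if x \<in> D then 0 else 1)) powr beta0"
      using succ_powr_ge[of "f x"] by simp
  qed
  finally show "M * (S + P / 2) \<le> T" .
qed

lemma h_nat: "\<exists>k. h n A x = real k"
  by (auto simp: h_def intro: exI[of _ 0])

lemma slice_induction_step:
  assumes C: "C \<subseteq> hypercube n" and D: "D \<subseteq> hypercube n" and le: "card D \<le> card C"
    and ihC: "2 ^ n * isop (card C / 2 ^ n) \<le> (\<Sum>x\<in>C. h n C x powr beta0)"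
    and ihD: "2 ^ n * isop (card D / 2 ^ n) \<le> (\<Sum>x\<in>D. h n D x powr beta0)"
  shows "2 ^ Suc n * isop ((card C + card D) / 2 ^ Suc n)
    \<le> (\<Sum>x\<in>C. (h n C x + (if x \<in> D then 0 else 1)) powr beta0)
      + (\<Sum>x\<in>D. (h n D x + (if x \<in> C then 0 else 1)) powr beta0)"
proof -
  define M x y :: real where "M = 2 ^ n" and "x = card C / M" and "y = card D / M"
  have fin: "finite C" "finite D" using finite_subset[OF C] finite_subset[OF D] by auto
  have M: "M > 0" by (simp add: M_def)
  have "card C \<le> card (hypercube n)" using C by (intro card_mono) auto
  then have "real (card C) \<le> real (2 ^ n)" unfolding card_hypercube of_nat_le_iff .
  then have xy: "0 \<le> y" "y \<le> x" "x \<le> 1"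
    using le M by (auto simp: x_def y_def M_def divide_right_mono)
  obtain f where f: "\<And>z. h n C z = real (f z)"
    using h_nat[of n C] by metis
  have "real (card C) - real (card D) \<le> real (card (C - D))"
    using card_Diff_subset_Int[of C D] card_mono[of D "C \<inter> D"] fin
    by (smt (verit) card_Un_le diff_card_le_card_Diff of_nat_diff of_nat_le_iff le)
  then have S: "M * (x - y) \<le> real (card (C - D))"
    using M by (simp add: x_def y_def right_diff_distrib)
  define T where "T = (\<Sum>z\<in>C. (h n C z + (if z \<in> D then 0 else 1)) powr beta0)"
  have P: "0 \<le> isop x" using xy by (intro isop_nonneg) auto
  have T: "M * powr_norm (isop x) (x - y) \<le> T" "M * ((x - y) + isop x / 2) \<le> T"
    using sum_powr_indicator_ge[OF fin(1) M P _ _ S, of f] ihC xy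
    by (simp_all add: T_def f x_def M_def)
  have "2 * isop ((x + y) / 2) \<le> T / M + isop y"
    using T M by (intro two_point_isop xy) (simp_all add: pos_le_divide_eq mult.commute)
  then have "M * (2 * isop ((x + y) / 2)) \<le> M * (T / M + isop y)"
    using M by (intro mult_left_mono) auto
  also have "\<dots> = T + M * isop y"
    using M by (simp add: distrib_left)
  also have "M * isop y \<le> (\<Sum>z\<in>D. h n D z powr beta0)"
    using ihD by (simp add: M_def y_def)
  \<comment> \<open>On the smaller slice the extra boundary edges are simply discarded.\<close>
  also have "\<dots> \<le> (\<Sum>z\<in>D. (h n D z + (if z \<in> C then 0 else 1)) powr beta0)"
    by (intro sum_mono powr_mono2) (auto simp: h_def)
  finally have "M * (2 * isop ((x + y) / 2)) \<le> T + (\<Sum>z\<in>D. (h n D z + (if z \<in> C then 0 else 1)) powr beta0)"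
    by simp
  moreover have "(x + y) / 2 = (card C + card D) / 2 ^ Suc n"
    by (simp add: x_def y_def M_def add_divide_distrib)
  ultimately show ?thesis by (simp add: M_def T_def)
qed

lemma isop_le_sum:
  assumes "A \<subseteq> hypercube n"
  shows "2 ^ n * isop (card A / 2 ^ n) \<le> (\<Sum>x\<in>A. h n A x powr beta0)"
  using assms
proof (induction n arbitrary: A)
  case 0
  have "card A \<le> card (hypercube 0)" using 0 by (intro card_mono) auto
  \<comment> \<open>In dimension 0 the measure is 0 or 1, where \<open>isop\<close>
    vanishes.\<close>
  then have "card A = 0 \<or> card A = 1" by (auto simp: card_hypercube)
  then have "isop (card A / 2 ^ 0) = 0" by auto
  then show ?case by (simp add: sum_nonneg)
next
  case (Suc n)
  let ?A = "cube_slice n A"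
  have card: "card A = card (?A 0) + card (?A 1)"
    using sum_cube_slice[OF Suc.prems, of "\<lambda>_. 1::nat"] by simp
  have sum: "(\<Sum>x\<in>A. h (Suc n) A x powr beta0)
      = (\<Sum>x\<in>?A 0. (h n (?A 0) x + (if x \<in> ?A 1 then 0 else 1)) powr beta0)
      + (\<Sum>x\<in>?A 1. (h n (?A 1) x + (if x \<in> ?A 0 then 0 else 1)) powr beta0)"
    unfolding sum_cube_slice[OF Suc.prems]
    by (intro arg_cong2[of _ _ _ _ "(+)"] sum.cong refl) (simp_all add: h_cube_slice[OF Suc.prems])
  note ih = Suc.IH[OF cube_slice_subset]
  show ?case
  proof (cases "card (?A 1) \<le> card (?A 0)")
    case True
    then show ?thesis
      using slice_induction_step[OF cube_slice_subset cube_slice_subset True ih ih]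
      by (simp add: sum card)
  next
    case False
    then have le: "card (?A 0) \<le> card (?A 1)" by simp
    show ?thesis
      using slice_induction_step[OF cube_slice_subset cube_slice_subset le ih ih]
      by (simp add: sum card add.commute)
  qed
qed

section \<open>Expectations, larger exponents and subcubes\<close>

lemma integral_cube_measure_h:
  assumes "A \<subseteq> hypercube n"
  shows "(\<integral>x. h n A x powr \<beta> \<partial>cube_measure n) = (\<Sum>x\<in>A. h n A x powr \<beta>) / 2 ^ n"
proof -
  have "(\<Sum>x\<in>hypercube n. h n A x powr \<beta>) = (\<Sum>x\<in>A. h n A x powr \<beta>)"
    using assms by (intro sum.mono_neutral_right) (auto simp: h_def)
  then show ?thesis
    by (simp add: cube_measure_def integral_uniform_count_measure card_hypercube)
qed

lemma measure_cube_measure: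
  assumes "A \<subseteq> hypercube n"
  shows "measure (cube_measure n) A = card A / 2 ^ n"
  using assms by (simp add: cube_measure_def measure_uniform_count_measure card_hypercube)

text \<open>Jensen's inequality for \<open>t powr e\<close>, obtained by summing the tangent bound
  at \<open>u x = v\<close>.\<close>

lemma sum_powr_ge_of_sum_ge:
  fixes u :: "'a \<Rightarrow> real" and v e :: real
  assumes "e \<ge> 1" "v > 0" "\<And>x. x \<in> A \<Longrightarrow> 0 \<le> u x" "card A * v \<le> sum u A"
  shows "card A * v powr e \<le> (\<Sum>x\<in>A. u x powr e)"
proof (cases "e = 1")
  case True
  then show ?thesis using assms by (simp add: sum_nonneg cong: sum.cong)
next
  case False
  then have e: "1 < e" using assms by simp
  have pt: "u x / v \<le> (1 - 1 / e) + (1 / e) * (u x powr e / v powr e)" if "x \<in> A" for x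
    using powr_one_sub_mult_le[of 1 "(u x / v) powr e" "1 / e"] e assms that
    by (simp add: powr_powr powr_divide)
  have "card A \<le> sum u A / v"
    using assms by (simp add: pos_le_divide_eq)
  also have "\<dots> \<le> (\<Sum>x\<in>A. (1 - 1 / e) + (1 / e) * (u x powr e / v powr e))"
    unfolding sum_divide_distrib by (intro sum_mono pt)
  also have "\<dots> = card A * (1 - 1 / e) + (1 / e) * ((\<Sum>x\<in>A. u x powr e) / v powr e)"
    by (simp add: sum.distrib sum_distrib_left sum_divide_distrib)
  finally have "(1 / e) * card A \<le> (1 / e) * ((\<Sum>x\<in>A. u x powr e) / v powr e)"
    by (simp add: algebra_simps)
  then have "card A \<le> (\<Sum>x\<in>A. u x powr e) / v powr e"
    using e by (subst (asm) mult_le_cancel_left_pos) auto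
  then show ?thesis
    using assms by (simp add: pos_le_divide_eq)
qed

text \<open>Here \<open>d\<close> is the number of fixed coordinates: each halves the measure, and
  exactly the flips of fixed coordinates leave \<open>A\<close>.\<close>

lemma subcube_data:
  assumes "subcube n A"
  obtains d where "measure (cube_measure n) A = 2 powr (- real d)"
    "\<And>x. x \<in> A \<Longrightarrow> h n A x = real d"
proof -
  from assms obtain I a where I: "I \<subseteq> {..<n}" "a \<in> I \<rightarrow>\<^sub>E {0, 1}"
    and A: "A = {x \<in> hypercube n. \<forall>i\<in>I. x i = a i}"
    unfolding subcube_def by blast
  have finI: "finite I" using I finite_subset by auto
  have a: "a i = 0 \<or> a i = 1" if "i \<in> I" for i using I(2) that by auto
  have sub: "A \<subseteq> hypercube n" using A by auto
  have "A = PiE {..<n} (\<lambda>i. if i \<in> I then {a i} else {0, 1})"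
  proof (intro set_eqI iffI)
    show "x \<in> PiE {..<n} (\<lambda>i. if i \<in> I then {a i} else {0, 1})" if "x \<in> A" for x
      using that I(1) by (auto simp: A hypercube_iff PiE_iff extensional_def)
    show "x \<in> A" if x: "x \<in> PiE {..<n} (\<lambda>i. if i \<in> I then {a i} else {0, 1})" for x
    proof -
      have "x i \<in> (if i \<in> I then {a i} else {0, 1})" if "i < n" for i
        using x that by (auto simp: PiE_iff)
      moreover have "x i = undefined" if "i \<ge> n" for i
        using x that by (auto simp: PiE_iff extensional_def)
      ultimately show ?thesis
        unfolding A hypercube_iff using I(1) a
        by (smt (verit) insertE lessThan_iff mem_Collect_eq singletonD subsetD)
    qed
  qed
  then have "card A = (\<Prod>i<n. if i \<in> I then 1 else 2)"
    by (simp add: card_PiE) (intro prod.cong; simp)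
  also have "\<dots> = (\<Prod>i\<in>{..<n} - I. 2)"
    by (intro prod.mono_neutral_cong_right) auto
  also have "\<dots> = 2 ^ (n - card I)"
    using I finI by (simp add: card_Diff_subset)
  finally have card: "card A = 2 ^ (n - card I)" .
  have "card I \<le> n" using card_mono[OF _ I(1)] by simp
  then have "(2::real) ^ (n - card I) / 2 ^ n = 1 / 2 ^ card I"
    by (simp add: power_diff)
  then have "measure (cube_measure n) A = 2 powr (- real (card I))"
    by (simp add: measure_cube_measure[OF sub] card powr_minus powr_realpow inverse_eq_divide)
  moreover have "h n A x = real (card I)" if "x \<in> A" for x
  proof -
    have x: "x \<in> hypercube n" "\<And>i. i \<in> I \<Longrightarrow> x i = a i" using that A by auto
    have "{i. i < n \<and> x(i := 1 - x i) \<notin> A} = I"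
    proof (intro set_eqI iffI)
      fix i assume "i \<in> {i. i < n \<and> x(i := 1 - x i) \<notin> A}"
      then show "i \<in> I"
        using x hypercube_flip[OF x(1)] by (auto simp: A split: if_splits)
    next
      fix i assume i: "i \<in> I"
      then have "i < n" using I by auto
      then show "i \<in> {i. i < n \<and> x(i := 1 - x i) \<notin> A}"
        using i x hypercube_value[OF x(1), of i] by (auto simp: A intro!: bexI[of _ i])
    qed
    then show ?thesis using h_eq_card_flips[OF sub that] by simp
  qed
  ultimately show thesis using that by blast
qed

theorem theorem1p1:
  fixes n :: nat and A :: "(nat \<Rightarrow> nat) set"
  assumes "n \<ge> 1" and "A \<subseteq> hypercube n"
  shows "(\<integral>x. h n A x powr beta0 \<partial>cube_measure n) \<ge> t_log_pow beta0 (star (measure (cube_measure n) A))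
    \<and> (measure (cube_measure n) A \<le> 1 / 2 \<longrightarrow>
         (\<forall>\<beta> \<ge> beta0. (\<integral>x. h n A x powr \<beta> \<partial>cube_measure n) \<ge> t_log_pow \<beta> (measure (cube_measure n) A)))
    \<and> (subcube n A \<longrightarrow>
         (\<integral>x. h n A x powr beta0 \<partial>cube_measure n) = t_log_pow beta0 (star (measure (cube_measure n) A)) \<and>
         (\<forall>\<beta> \<ge> beta0. (\<integral>x. h n A x powr \<beta> \<partial>cube_measure n) = t_log_pow \<beta> (measure (cube_measure n) A)))"
proof (intro conjI impI allI)
  define \<mu> where "\<mu> = measure (cube_measure n) A"
  have \<mu>: "\<mu> = card A / 2 ^ n" and sum: "2 ^ n * isop \<mu> \<le> (\<Sum>x\<in>A. h n A x powr beta0)"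
    using measure_cube_measure isop_le_sum assms(2) by (simp_all add: \<mu>_def)
  have "t_log_pow beta0 (star \<mu>) \<le> isop \<mu>"
    by (rule tlog_star_le_isop)
  also have "\<dots> \<le> (\<integral>x. h n A x powr beta0 \<partial>cube_measure n)"
    using sum by (simp add: integral_cube_measure_h[OF assms(2)] pos_le_divide_eq mult.commute)
  finally show main: "t_log_pow beta0 (star (measure (cube_measure n) A))
      \<le> (\<integral>x. h n A x powr beta0 \<partial>cube_measure n)"
    by (simp add: \<mu>_def)
  {
    fix \<beta> assume half: "measure (cube_measure n) A \<le> 1 / 2" and \<beta>: "beta0 \<le> \<beta>"
    show "t_log_pow \<beta> (measure (cube_measure n) A) \<le> (\<integral>x. h n A x powr \<beta> \<partial>cube_measure n)"
    proof (cases "card A = 0")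
      case True
      then show ?thesis
        using measure_cube_measure[OF assms(2)]
        by (simp add: t_log_pow_def integral_nonneg_AE)
    next
      case False
      then have pos: "0 < \<mu>" "\<mu> \<le> 1/2" using half by (auto simp: \<mu> simp flip: \<mu>_def)
      define w where "w = log 2 (1 / \<mu>)"
      \<comment> \<open>Measure at most 1/2 makes \<open>w powr beta0\<close> positive, as Jensen
        requires here.\<close>
      have "log 2 2 \<le> w"
        unfolding w_def using pos by (subst log_le_cancel_iff) (auto simp: field_simps)
      then have w: "1 \<le> w" by simp
      have "star \<mu> = \<mu>" using pos by (simp add: star_def)
      then have "\<mu> * w powr beta0 \<le> (\<Sum>x\<in>A. h n A x powr beta0) / 2 ^ n"
        using main by (simp add: integral_cube_measure_h[OF assms(2)] t_log_pow_def w_def flip: \<mu>_def)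
      then have "card A * w powr beta0 \<le> (\<Sum>x\<in>A. h n A x powr beta0)"
        by (simp add: \<mu> divide_le_cancel)
      \<comment> \<open>Jensen for the exponent \<open>\<beta> / beta0 >= 1\<close>, applied to
        \<open>h\<close> raised to \<open>beta0\<close>.\<close>
      then have "card A * (w powr beta0) powr (\<beta> / beta0) \<le> (\<Sum>x\<in>A. (h n A x powr beta0) powr (\<beta> / beta0))"
        using sum_powr_ge_of_sum_ge[of "\<beta> / beta0" "w powr beta0" A "\<lambda>x. h n A x powr beta0"] \<beta> w
        by (simp add: le_divide_eq)
      then have "card A * w powr \<beta> \<le> (\<Sum>x\<in>A. h n A x powr \<beta>)"
        by (simp add: powr_powr)
      then have "\<mu> * w powr \<beta> \<le> (\<Sum>x\<in>A. h n A x powr \<beta>) / 2 ^ n"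
        by (simp add: \<mu> divide_right_mono)
      then show ?thesis
        by (simp add: integral_cube_measure_h[OF assms(2)] t_log_pow_def w_def flip: \<mu>_def)
    qed
  }
  assume "subcube n A"
  then obtain d where d: "\<mu> = 2 powr (- real d)" "\<And>x. x \<in> A \<Longrightarrow> h n A x = real d"
    unfolding \<mu>_def by (rule subcube_data) blast
  have "log 2 (1 / \<mu>) = real d" by (simp add: d log_divide)
  then have t_log: "t_log_pow \<beta> \<mu> = \<mu> * real d powr \<beta>" for \<beta>
    by (simp add: t_log_pow_def)
  have eq: "(\<integral>x. h n A x powr \<beta> \<partial>cube_measure n) = t_log_pow \<beta> \<mu>" for \<beta>
    unfolding t_log by (simp add: integral_cube_measure_h[OF assms(2)] d(2) \<mu>)
  then show "(\<integral>x. h n A x powr \<beta> \<partial>cube_measure n) = t_log_pow \<beta> (measure (cube_measure n) A)" for \<beta>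
    by (simp add: \<mu>_def)
  show "(\<integral>x. h n A x powr beta0 \<partial>cube_measure n) = t_log_pow beta0 (star (measure (cube_measure n) A))"
  proof (cases "d = 0")
    case True
    \<comment> \<open>For the whole cube both sides vanish, by \<open>0 powr beta0 = 0\<close> and
      the factor \<open>star \<mu> = 0\<close>.\<close>
    then have "star \<mu> = 0" using d by (simp add: star_def)
    then show ?thesis
      unfolding eq t_log using True by (simp add: t_log_pow_def flip: \<mu>_def)
  next
    case False
    then have "\<mu> \<le> 2 powr (- 1)" unfolding d by (intro powr_mono) auto
    then have "star \<mu> = \<mu>" by (simp add: star_def powr_minus)
    then show ?thesis unfolding eq by (simp flip: \<mu>_def)
  qed
qed

end
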